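(* For positive integers $n$ and $p$, and a parameter $x$, the monic orthogonal polynomials $\Omega_n^{(p)}(y)$ with respect to the sequence $\left(E_k^{(p)}(x)\right)_{k\ge0}$ are given by \[ \Omega_n^{(p)}(y)=\frac{i^n n!}{2^n}\,P_n^{\left(\frac p2\right)}\!\left(-i\left(y-x+\frac p2\right);\frac{\pi}{2}\right). \]
   Context: The higher-order Euler polynomials are defined by $\left(\frac{2}{e^{z}+1}\right)^{p}e^{xz}=\sum_{n\ge0}E_{n}^{(p)}(x)\frac{z^{n}}{n!}$. Given a sequence $(m_k)$, the monic orthogonal polynomials with respect to it are monic $P_n$ with $\deg P_n=n$ such that $y^rP_n(y)|_{y^k=m_k}=0$ for all $0\le r<n$ (expand in powers of $y$ and replace each $y^k$ by $m_k$). The Meixner–Pollaczek polynomials are \[ P_{n}^{(\lambda)}(y;\phi)=\frac{(2\lambda)_{n}}{n!}e^{in\phi}\,{}_{2}F_{1}\!\left(\genfrac{}{}{0pt}{}{-n,\ \lambda+iy}{2\lambda}\,\bigg|\,1-e^{-2i\phi}\right), \] where $(a)_n=a(a+1)\cdots(a+n-1)$ is the Pochhammer symbol and ${}_2F_1$ is the Gauss hypergeometric function. *)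

theory Defs
  imports "HOL-Analysis.Analysis" "HOL-Computational_Algebra.Computational_Algebra"
begin

text \<open>
  The value at \<open>x\<close> of the \<open>n\<close>-th Euler polynomial of order \<open>p\<close>. The generating function is a formal
  power series in \<open>z\<close>, with \<open>fps_exp c\<close> standing for \<open>e^(c z)\<close>. The division is by a unit,
  since \<open>e^z + 1\<close> has constant coefficient 2.
\<close>

definition higher_euler :: "nat \<Rightarrow> nat \<Rightarrow> complex \<Rightarrow> complex" where
  "higher_euler p n x =
     fact n * fps_nth ((2 / (fps_exp 1 + 1)) ^ p * fps_exp x) n"

text \<open>
  Expand \<open>q\<close> in powers of \<open>y\<close> and replace each \<open>y^k\<close> by \<open>m k\<close>.
\<close>

definition umbral_eval :: "(nat \<Rightarrow> 'a) \<Rightarrow> 'a::comm_ring_1 poly \<Rightarrow> 'a" where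
  "umbral_eval m q = (\<Sum>k\<le>degree q. coeff q k * m k)"

definition monic_orthogonal_poly :: "(nat \<Rightarrow> 'a) \<Rightarrow> nat \<Rightarrow> 'a::comm_ring_1 poly \<Rightarrow> bool" where
  "monic_orthogonal_poly m n P \<longleftrightarrow>
     degree P = n \<and> lead_coeff P = 1 \<and> (\<forall>r<n. umbral_eval m (monom 1 r * P) = 0)"

text \<open>
  The Gauss hypergeometric series \<open>\<Sum>k. (a)\<^sub>k (b)\<^sub>k / (c)\<^sub>k * z^k / k!\<close>. When \<open>a\<close> is a nonpositive
  integer, all but finitely many terms vanish, so that the value is meaningful for every \<open>z\<close>,
  in particular outside the unit disc.
\<close>

definition hypergeo_2F1 :: "complex \<Rightarrow> complex \<Rightarrow> complex \<Rightarrow> complex \<Rightarrow> complex" where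
  "hypergeo_2F1 a b c z = eval_fps (fps_hypergeo [a, b] [c] 1) z"

definition meixner_pollaczek :: "nat \<Rightarrow> real \<Rightarrow> complex \<Rightarrow> real \<Rightarrow> complex" where
  "meixner_pollaczek n lam y phi =
     of_real (pochhammer (2 * lam) n / fact n) * exp (\<i> * of_nat n * of_real phi) *
     hypergeo_2F1 (- of_nat n) (of_real lam + \<i> * y) (of_real (2 * lam))
       (1 - exp (- 2 * \<i> * of_real phi))"

end

(* Write u = y - x and let L be the umbral functional. The differential equation of the generating
   function says L (u q(y) + (u + p) q(y + 1)) = 0 for every polynomial q. It yields
   L ((-u)_r (p + u)_k) = (p)_(r+k) / 2^(r+k), first for k = 0 and then by induction on k, since
   (r - u) + (p + u + k) = p + r + k. The hypergeometric sum expands the claimed polynomial in the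
   (p + u)_k, so pairing it with (-u)_r gives a multiple of the n-th difference of the polynomial
   a \<mapsto> (a)_r of degree r: this vanishes for r < n and not for r = n, the latter giving uniqueness. *)

theory Submission
  imports Defs
begin

section \<open>The umbral functional as a linear map\<close>

text \<open>A common bound \<open>N\<close> replaces \<open>degree q\<close>, which may drop under
  addition or scaling, so that linearity can be checked term by term.\<close>

lemma umbral_eval_eq_sum:
  assumes "degree q \<le> N"
  shows "umbral_eval m q = (\<Sum>k\<le>N. coeff q k * m k)"
  unfolding umbral_eval_def
  by (rule sum.mono_neutral_left) (use assms in \<open>auto simp: coeff_eq_0\<close>)

lemma umbral_eval_0 [simp]: "umbral_eval m 0 = 0"
  by (simp add: umbral_eval_def)

lemma umbral_eval_1 [simp]: "umbral_eval m 1 = m 0"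
  by (simp add: umbral_eval_def)

lemma umbral_eval_smult: "umbral_eval m (smult c q) = c * umbral_eval m q"
  by (simp add: umbral_eval_eq_sum[of _ "degree q"] degree_smult_le sum_distrib_left mult.assoc)

lemma umbral_eval_add: "umbral_eval m (q + r) = umbral_eval m q + umbral_eval m r"
proof -
  define N where "N = max (degree q) (degree r)"
  have "degree q \<le> N" "degree r \<le> N" "degree (q + r) \<le> N"
    by (auto simp: N_def degree_add_le_max)
  then show ?thesis
    by (simp add: umbral_eval_eq_sum[of _ N] sum.distrib algebra_simps)
qed

lemma umbral_eval_minus: "umbral_eval m (- q) = - umbral_eval m q"
  using umbral_eval_smult[of m "-1" q] by simp

lemma umbral_eval_diff: "umbral_eval m (q - r) = umbral_eval m q - umbral_eval m r"
  using umbral_eval_add[of m q "- r"] by (simp add: umbral_eval_minus)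

lemma umbral_eval_sum: "umbral_eval m (\<Sum>i\<in>A. f i) = (\<Sum>i\<in>A. umbral_eval m (f i))"
  by (induction A rule: infinite_finite_induct) (auto simp: umbral_eval_add)

text \<open>Multiplication by y shifts the moment sequence; on exponential generating functions this
  is differentiation.\<close>

lemma umbral_eval_pCons:
  "umbral_eval m (pCons a q) = a * m 0 + umbral_eval (\<lambda>k. m (Suc k)) q"
  by (simp add: umbral_eval_eq_sum[of "pCons a q" "Suc (degree q)"] umbral_eval_def
      degree_pCons_le sum.atMost_Suc_shift del: sum.atMost_Suc)

lemma umbral_eval_monom: "umbral_eval m (monom c j) = c * m j"
  by (induction j arbitrary: m) (simp_all add: monom_0 monom_Suc umbral_eval_pCons)

text \<open>Binomial theorem: if \<open>F\<close> is the exponential generating function of the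
  moments, translation by 1 corresponds to multiplying \<open>F\<close> by e^z.\<close>

lemma umbral_eval_linear_power:
  fixes F :: "'a::field_char_0 fps"
  shows "umbral_eval (\<lambda>k. fact k * fps_nth F k) ([:1, 1:] ^ n) = fact n * fps_nth (F * fps_exp 1) n"
proof -
  have "fact n * fps_nth (F * fps_exp 1) n = (\<Sum>k\<le>n. fact n * (fps_nth F k / fact (n - k)))"
    by (simp add: fps_mult_nth sum_distrib_left atLeast0AtMost)
  also have "\<dots> = (\<Sum>k\<le>n. coeff ([:1, 1:] ^ n) k * (fact k * fps_nth F k))"
    by (intro sum.cong refl) (simp add: coeff_linear_poly_power binomial_fact field_simps)
  also have "\<dots> = umbral_eval (\<lambda>k. fact k * fps_nth F k) ([:1, 1:] ^ n)"
    by (simp add: umbral_eval_def degree_linear_power)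
  finally show ?thesis ..
qed

section \<open>Differential equation of the Euler generating function\<close>

text \<open>With W = 2/(e^z + 1), the logarithmic derivative of G = W^p e^(xz) is x + p W'/W.
  Differentiating W (e^z + 1) = 2 gives W' (e^z + 1) = -W e^z, so the factor e^z + 1 clears the
  denominator.\<close>

lemma higher_euler_ode:
  fixes p :: nat and x :: complex
  defines "G \<equiv> (2 / (fps_exp 1 + 1)) ^ p * fps_exp x"
  shows "(fps_deriv G - fps_const x * G) * (fps_exp 1 + 1) = - (of_nat p * G * fps_exp 1)"
proof -
  define E :: "complex fps" where "E = fps_exp 1"
  define W :: "complex fps" where "W = 2 / (E + 1)"
  have W: "W * (E + 1) = 2"
  proof -
    have "fps_nth (E + 1) 0 \<noteq> 0" by (simp add: E_def)
    then show ?thesis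
      unfolding W_def by (simp add: fps_divide_unit mult.assoc inverse_mult_eq_1)
  qed
  have "fps_deriv (W * (E + 1)) = 0"
    unfolding W by (metis fps_deriv_numeral)
  then have W': "fps_deriv W * (E + 1) = - (W * E)"
    by (simp add: E_def algebra_simps eq_neg_iff_add_eq_0)
  have G: "G = W ^ p * fps_exp x"
    by (simp add: G_def W_def E_def)
  have "(fps_deriv G - fps_const x * G) * (E + 1) =
      of_nat p * W ^ (p - 1) * fps_exp x * (fps_deriv W * (E + 1))"
    by (simp add: G fps_deriv_power' algebra_simps)
  also have "\<dots> = - (of_nat p * G * E)"
    \<comment> \<open>For \<open>p = 0\<close> the exponent \<open>p - 1\<close> is truncated to 0,
      but the factor \<open>of_nat p\<close> vanishes.\<close>
    unfolding W' G by (cases p) (simp_all add: algebra_simps)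
  finally show ?thesis by (simp add: E_def)
qed

text \<open>For q = y^j the functional yields j! times the j-th coefficient of (G' - x G) + ((p - x)
  G + G') e^z, which is zero by the differential equation. Linearity extends this to every
  \<open>q\<close>.\<close>

lemma umbral_eval_higher_euler_shift:
  fixes q :: "complex poly" and p :: nat and x :: complex
  defines "m \<equiv> \<lambda>k. higher_euler p k x"
  shows "umbral_eval m ([:-x, 1:] * q + [:of_nat p - x, 1:] * pcompose q [:1, 1:]) = 0"
proof -
  define G where "G = (2 / (fps_exp 1 + 1)) ^ p * fps_exp x"
  have m: "m = (\<lambda>k. fact k * fps_nth G k)"
    by (simp add: m_def higher_euler_def G_def fun_eq_iff)
  have m_Suc: "(\<lambda>k. m (Suc k)) = (\<lambda>k. fact k * fps_nth (fps_deriv G) k)"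
    by (simp add: m fun_eq_iff algebra_simps)
  have split: "[:c, 1:] * r = smult c r + pCons 0 r" for c :: complex and r
    by simp
  have mono: "umbral_eval m ([:-x, 1:] * [:0, 1:] ^ j + [:of_nat p - x, 1:] * [:1, 1:] ^ j) = 0" for j
  proof -
    let ?E = "fps_exp 1 :: complex fps"
    have lin: "[:0, 1:] ^ j = (monom 1 j :: complex poly)"
      by (simp add: monom_altdef)
    have "umbral_eval m' ([:0, 1:] ^ j) = m' j" for m' :: "nat \<Rightarrow> complex"
      unfolding lin by (simp add: umbral_eval_monom)
    then have "umbral_eval m ([:-x, 1:] * [:0, 1:] ^ j + [:of_nat p - x, 1:] * [:1, 1:] ^ j) =
        fact j * fps_nth (fps_deriv G - fps_const x * G + (fps_const (of_nat p - x) * G + fps_deriv G) * ?E) j"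
      unfolding split umbral_eval_add umbral_eval_smult umbral_eval_pCons m_Suc
      unfolding m umbral_eval_linear_power by (simp add: ring_distribs mult.assoc)
    also have "fps_const (of_nat p - x) = of_nat p - fps_const x"
      by (metis fps_const_sub fps_of_nat)
    also have "fps_deriv G - fps_const x * G + ((of_nat p - fps_const x) * G + fps_deriv G) * ?E
        = (fps_deriv G - fps_const x * G) * (?E + 1) + of_nat p * G * ?E"
      by (simp add: algebra_simps)
    also have "\<dots> = 0"
      using higher_euler_ode[of p x] by (simp add: G_def)
    finally show ?thesis by simp
  qed
  obtain c N where q: "q = (\<Sum>j\<le>N. smult (c j) ([:0, 1:] ^ j))"
    using poly_as_sum_of_monoms[of q, symmetric] unfolding monom_altdef by blast
  have "pcompose ([:0, 1:] ^ j) [:1, 1:] = [:1, 1 :: complex:] ^ j" for j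
    by (induction j) (simp_all add: pcompose_1 pcompose_mult pcompose_pCons)
  then have "[:-x, 1:] * q + [:of_nat p - x, 1:] * pcompose q [:1, 1:] =
      (\<Sum>j\<le>N. smult (c j)
        ([:-x, 1:] * [:0, 1:] ^ j + [:of_nat p - x, 1:] * [:1, 1:] ^ j))"
    unfolding q by (simp only: pcompose_sum pcompose_smult sum_distrib_left mult_smult_right
        smult_add_right sum.distrib)
  then show ?thesis
    by (simp only: umbral_eval_sum umbral_eval_smult mono) simp
qed

section \<open>Mixed moments of two families of rising factorials\<close>

lemma degree_pochhammer_linear:
  fixes a b :: "'a::idom"
  assumes "b \<noteq> 0"
  shows "degree (pochhammer [:a, b:] k) = k" "lead_coeff (pochhammer [:a, b:] k) = b ^ k"
proof -
  have "degree (pochhammer [:a, b:] k) = k \<and> lead_coeff (pochhammer [:a, b:] k) = b ^ k"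
  proof (induction k)
    case (Suc k)
    have *: "[:a, b:] + of_nat k = [:a + of_nat k, b:]"
      by (simp add: of_nat_poly)
    have "pochhammer [:a, b:] k \<noteq> 0" using Suc assms by auto
    then have "degree (pochhammer [:a, b:] (Suc k)) = Suc k"
      using Suc assms by (simp add: pochhammer_Suc * degree_mult_eq del: mult_pCons_right)
    moreover have "lead_coeff (pochhammer [:a, b:] (Suc k)) = b ^ Suc k"
      unfolding pochhammer_Suc * lead_coeff_mult conjunct2[OF Suc] using assms by simp
    ultimately show ?case by blast
  qed simp
  then show "degree (pochhammer [:a, b:] k) = k" "lead_coeff (pochhammer [:a, b:] k) = b ^ k"
    by auto
qed

lemma poly_pochhammer: "poly (pochhammer q k) y = pochhammer (poly q y) k"
  by (induction k) (simp_all add: pochhammer_Suc algebra_simps)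

lemma pcompose_pochhammer: "pcompose (pochhammer q k) r = pochhammer (pcompose q r) k"
  for q r :: "'a::comm_ring_1 poly"
  by (induction k) (simp_all add: pochhammer_Suc pcompose_1 pcompose_mult pcompose_add
      pcompose_const of_nat_poly)

text \<open>With u = y - x, the family (-u)_r serves as test polynomials and (p + u)_k carries the
  hypergeometric expansion. Their mixed moments depend only on r + k.\<close>

lemma umbral_eval_higher_euler_pochhammer:
  fixes p :: nat and x :: complex
  defines "m \<equiv> \<lambda>k. higher_euler p k x"
  shows "umbral_eval m (pochhammer [:x, -1:] r * pochhammer [:of_nat p - x, 1:] k) =
    pochhammer (of_nat p) (r + k) / 2 ^ (r + k)"
proof (induction k arbitrary: r)
  case 0
  show ?case
  proof (induction r)
    case 0
    have "m 0 = 1"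
      by (simp add: m_def higher_euler_def fps_nth_power_0)
    then show ?case by simp
  next
    case (Suc r)
    let ?f = "pochhammer [:x, -1:]"
    \<comment> \<open>The shift relation is applied to q = (1 - u)_r, chosen so that u q(y) =
      -(-u)_(r+1) and q(y + 1) = (-u)_r.\<close>
    have 1: "[:-x, 1:] * pochhammer [:x + 1, -1:] r = - ?f (Suc r)"
      by (simp add: pochhammer_rec one_pCons add.commute)
    \<comment> \<open>Here p + u = (p + r) - (r - u), and r - u is the next factor of (-u)_r. The
      term (-u)_(r+1) thus occurs twice in the relation, whence the factor (p + r)/2 below.\<close>
    have 2: "[:of_nat p - x, 1:] * ?f r = smult (of_nat p + of_nat r) (?f r) - ?f (Suc r)"
    proof -
      have "[:of_nat p - x, 1:] = [:of_nat p + of_nat r:] - ([:x, -1:] + of_nat r)"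
        by (simp add: of_nat_poly)
      then show ?thesis
        by (simp only: left_diff_distrib) (simp add: pochhammer_Suc mult.commute)
    qed
    have "umbral_eval m (- ?f (Suc r) + (smult (of_nat p + of_nat r) (?f r) - ?f (Suc r))) = 0"
      using umbral_eval_higher_euler_shift[of p x "pochhammer [:x + 1, -1:] r"]
      unfolding 1 pcompose_pochhammer m_def by (simp add: pcompose_pCons flip: 2)
    then have step: "umbral_eval m (?f (Suc r)) = (of_nat p + of_nat r) / 2 * umbral_eval m (?f r)"
      unfolding umbral_eval_add umbral_eval_diff umbral_eval_minus umbral_eval_smult
      by (simp add: algebra_simps)
    have IH: "umbral_eval m (?f r) = pochhammer (of_nat p) r / 2 ^ r"
      using Suc.IH by simp
    show ?case
      by (simp add: step IH pochhammer_Suc[of "of_nat p :: complex"])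
  qed
next
  case (Suc k)
  let ?f = "pochhammer [:x, -1:]" and ?g = "pochhammer [:of_nat p - x, 1:]"
  \<comment> \<open>The new factor of the second family is traded for one of the first. The
    hypothesis is therefore used at both \<open>r\<close> and \<open>Suc r\<close>, which is why
    \<open>r\<close> is arbitrary in the induction.\<close>
  have "?f r * ?g (Suc k) = smult (of_nat p + of_nat (r + k)) (?f r * ?g k) - ?f (Suc r) * ?g k"
  proof -
    have "[:of_nat p - x, 1:] + of_nat k = [:of_nat p + of_nat (r + k):] - ([:x, -1:] + of_nat r)"
      by (simp add: of_nat_poly)
    moreover have "f * (g * B) = smult c (f * g) - f * A * g" if "B = [:c:] - A"
      for f g A B :: "complex poly" and c
      unfolding that by (simp add: right_diff_distrib mult_ac)
    ultimately show ?thesis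
      unfolding pochhammer_Suc by blast
  qed
  then have "umbral_eval m (?f r * ?g (Suc k)) =
      (of_nat p + of_nat (r + k)) * (pochhammer (of_nat p) (r + k) / 2 ^ (r + k))
      - pochhammer (of_nat p) (Suc r + k) / 2 ^ (Suc r + k)"
    by (simp only: umbral_eval_diff umbral_eval_smult Suc.IH)
  \<comment> \<open>If t denotes the right-hand side, the two terms are 2t and t.\<close>
  also have "\<dots> = pochhammer (of_nat p) (r + Suc k) / 2 ^ (r + Suc k)"
    by (simp add: pochhammer_Suc field_simps)
  finally show ?case .
qed

section \<open>Iterated differences of rising factorials\<close>

text \<open>Pascal's rule: an (n+1)-fold difference is the n-fold difference of a first
  difference.\<close>

lemma alternating_binomial_sum_Suc:
  fixes f :: "nat \<Rightarrow> 'a::comm_ring_1"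
  shows "(\<Sum>k\<le>Suc n. (-1) ^ k * of_nat (Suc n choose k) * f k) =
    (\<Sum>k\<le>n. (-1) ^ k * of_nat (n choose k) * (f k - f (Suc k)))"
proof -
  have "(\<Sum>k\<le>Suc n. (-1) ^ k * of_nat (Suc n choose k) * f k) =
      f 0 + (\<Sum>k\<le>n. (-1) ^ Suc k * of_nat (n choose Suc k) * f (Suc k))
      - (\<Sum>k\<le>n. (-1) ^ k * of_nat (n choose k) * f (Suc k))"
    by (simp add: sum.atMost_Suc_shift sum.distrib sum_negf sum_subtractf algebra_simps
        del: sum.atMost_Suc)
  also have "f 0 + (\<Sum>k\<le>n. (-1) ^ Suc k * of_nat (n choose Suc k) * f (Suc k)) =
      (\<Sum>k\<le>Suc n. (-1) ^ k * of_nat (n choose k) * f k)"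
    by (simp add: sum.atMost_Suc_shift del: sum.atMost_Suc)
  also have "\<dots> = (\<Sum>k\<le>n. (-1) ^ k * of_nat (n choose k) * f k)"
    by (simp add: binomial_eq_0)
  finally show ?thesis
    by (simp add: sum_subtractf right_diff_distrib del: sum.atMost_Suc)
qed

text \<open>Since (a)_r - (a + 1)_r = -r (a + 1)_(r-1), each difference lowers \<open>r\<close> and
  \<open>n\<close> together and shifts \<open>a\<close>. For r < n a constant is eventually
  differenced; for r = n the factors accumulate to (-1)^n n!.\<close>

lemma alternating_sum_pochhammer:
  fixes a :: "'a::field_char_0"
  assumes "r \<le> n"
  shows "(\<Sum>k\<le>n. (-1) ^ k * of_nat (n choose k) * pochhammer (a + of_nat k) r) =
    (if r = n then (-1) ^ n * fact n else 0)"
  using assms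
proof (induction n arbitrary: r a)
  case (Suc n)
  show ?case
  proof (cases r)
    case 0
    then show ?thesis
      unfolding alternating_binomial_sum_Suc by simp
  next
    case (Suc s)
    have "pochhammer (a + of_nat k) r - pochhammer (a + of_nat (Suc k)) r =
        - of_nat r * pochhammer (a + 1 + of_nat k) s" for k
      \<comment> \<open>The common factor is (a + k + 1)_s: the first symbol adds a + k in front,
        the second adds a + k + r at the end.\<close>
      unfolding Suc pochhammer_rec[of "a + of_nat k"] pochhammer_rec'[of "a + of_nat (Suc k)"]
      by (simp add: algebra_simps)
    then have "(\<Sum>k\<le>Suc n. (-1) ^ k * of_nat (Suc n choose k) * pochhammer (a + of_nat k) r) =
        - of_nat r * (\<Sum>k\<le>n. (-1) ^ k * of_nat (n choose k) * pochhammer (a + 1 + of_nat k) s)"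
      unfolding alternating_binomial_sum_Suc by (simp add: sum_distrib_left mult_ac)
    then show ?thesis
      using Suc.IH[of s "a + 1"] Suc.prems \<open>r = Suc s\<close>
      by (auto simp: algebra_simps simp del: sum.atMost_Suc)
  qed
qed simp

section \<open>Orthogonality and uniqueness for general moments\<close>

text \<open>The family \<open>b\<close> has one member in each degree below \<open>n\<close>, so the
  top coefficient of \<open>q\<close> can be cleared repeatedly. Bounding coefficients instead of
  the degree makes the case \<open>n = 0\<close> say \<open>q = 0\<close>.\<close>

lemma umbral_eval_mult_eq_0:
  fixes P :: "'a::field poly"
  assumes b: "\<And>r. r < n \<Longrightarrow> degree (b r) = r \<and> b r \<noteq> 0 \<and> umbral_eval m (b r * P) = 0"
    and "\<And>i. i \<ge> n \<Longrightarrow> coeff q i = 0"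
  shows "umbral_eval m (q * P) = 0"
proof -
  have "umbral_eval m (q * P) = 0" if "N \<le> n" "\<forall>i\<ge>N. coeff q i = 0" for N q
    using that
  proof (induction N arbitrary: q)
    case 0
    then have "q = 0" by (simp add: poly_eq_iff)
    then show ?case by simp
  next
    case (Suc N)
    have bN: "degree (b N) = N" "b N \<noteq> 0" "umbral_eval m (b N * P) = 0"
      using b[of N] Suc.prems by auto
    have lead: "coeff (b N) N \<noteq> 0"
      using bN by (metis leading_coeff_0_iff)
    define c where "c = coeff q N / coeff (b N) N"
    have "coeff (q - smult c (b N)) i = 0" if "i \<ge> N" for i
      using that bN lead Suc.prems(2)
      by (cases "i = N") (auto simp: c_def coeff_eq_0)
    then have "umbral_eval m ((q - smult c (b N)) * P) = 0"
      using Suc by simp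
    then show ?case
      using bN by (simp add: left_diff_distrib umbral_eval_diff umbral_eval_smult)
  qed
  from this[of n q] assms(2) show ?thesis by simp
qed

lemma monic_orthogonal_poly_mult_eq_0:
  fixes P :: "'a::field poly"
  assumes "monic_orthogonal_poly m n P" "\<And>i. i \<ge> n \<Longrightarrow> coeff q i = 0"
  shows "umbral_eval m (q * P) = 0"
  using assms by (intro umbral_eval_mult_eq_0[of n "monom 1"])
    (auto simp: monic_orthogonal_poly_def degree_monom_eq)

text \<open>For arbitrary moments uniqueness can fail; nonzero squared norms below \<open>n\<close>
  secure it. The difference \<open>D\<close> of two candidates has degree d < n and is orthogonal to
  \<open>P d\<close>, yet modulo lower degrees it is \<open>lead_coeff D\<close> times
  \<open>P d\<close>.\<close>

lemma monic_orthogonal_poly_unique: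
  fixes m :: "nat \<Rightarrow> 'a::field"
  assumes P: "\<And>d. d < n \<Longrightarrow> monic_orthogonal_poly m d (P d) \<and> umbral_eval m (P d * P d) \<noteq> 0"
    and Q: "monic_orthogonal_poly m n Q" and R: "monic_orthogonal_poly m n R"
  shows "Q = R"
proof (rule ccontr)
  define D where "D = Q - R"
  define d where "d = degree D"
  assume "Q \<noteq> R"
  then have "D \<noteq> 0" by (simp add: D_def)
  have "coeff D i = 0" if "i \<ge> n" for i
    using that Q R by (cases "i = n") (auto simp: D_def monic_orthogonal_poly_def coeff_eq_0)
  then have "d < n"
    using \<open>D \<noteq> 0\<close> by (metis d_def leading_coeff_0_iff not_le)
  then have Pd: "monic_orthogonal_poly m d (P d)" "umbral_eval m (P d * P d) \<noteq> 0"
    using P by auto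
  then have deg: "degree (P d) = d" "coeff (P d) d = 1"
    by (auto simp: monic_orthogonal_poly_def)
  have "umbral_eval m (P d * D) = 0"
    unfolding D_def right_diff_distrib umbral_eval_diff
    using monic_orthogonal_poly_mult_eq_0[OF Q, of "P d"]
      monic_orthogonal_poly_mult_eq_0[OF R, of "P d"] deg \<open>d < n\<close>
    by (simp add: coeff_eq_0)
  moreover have "umbral_eval m ((D - smult (lead_coeff D) (P d)) * P d) = 0"
  proof (rule monic_orthogonal_poly_mult_eq_0[OF Pd(1)])
    show "coeff (D - smult (lead_coeff D) (P d)) i = 0" if "i \<ge> d" for i
      using that deg by (cases "i = d") (auto simp: d_def coeff_eq_0)
  qed
  moreover have "(D - smult (lead_coeff D) (P d)) * P d =
      P d * D - smult (lead_coeff D) (P d * P d)"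
    by (simp add: algebra_simps)
  ultimately have "lead_coeff D * umbral_eval m (P d * P d) = 0"
    by (simp add: umbral_eval_diff umbral_eval_smult)
  then show False
    using \<open>D \<noteq> 0\<close> Pd(2) by simp
qed

section \<open>The explicit orthogonal polynomial\<close>

text \<open>This is (-1)^n (p)_n / 2^n times 2F1(-n, p + u; p; 2) with u = y - x, as a polynomial in
  y.\<close>

definition euler_orthogonal :: "nat \<Rightarrow> complex \<Rightarrow> nat \<Rightarrow> complex poly" where
  "euler_orthogonal p x n = smult ((-1) ^ n * pochhammer (of_nat p) n / 2 ^ n)
     (\<Sum>k\<le>n. smult ((-1) ^ k * of_nat (n choose k) * 2 ^ k / pochhammer (of_nat p) k)
       (pochhammer [:of_nat p - x, 1:] k))"

lemma pochhammer_of_nat_neq_0: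
  assumes "p \<ge> 1"
  shows "pochhammer (of_nat p :: 'a::field_char_0) k \<noteq> 0"
proof
  assume "pochhammer (of_nat p :: 'a) k = 0"
  then obtain j where "of_nat p = - (of_nat j :: 'a)"
    by (auto simp: pochhammer_eq_0_iff)
  then have "of_nat (p + j) = (0 :: 'a)" by simp
  with assms show False by (simp only: of_nat_eq_0_iff)
qed

text \<open>Only the summand k = n reaches degree n, and its factor (-2)^n / (p)_n cancels the
  prefactor.\<close>

lemma coeff_euler_orthogonal:
  assumes "p \<ge> 1" "i \<ge> n"
  shows "coeff (euler_orthogonal p x n) i = (if i = n then 1 else 0)"
proof -
  have "coeff (pochhammer [:of_nat p - x, 1:] k) i = (if k = i then 1 else 0)" if "k \<le> n" for k
    using that assms degree_pochhammer_linear[of 1 "of_nat p - x" k]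
    by (auto simp: coeff_eq_0)
  then have "coeff (euler_orthogonal p x n) i = (-1) ^ n * pochhammer (of_nat p) n / 2 ^ n *
      (\<Sum>k\<le>n. if k = i then (-1) ^ k * of_nat (n choose k) * 2 ^ k / pochhammer (of_nat p) k else 0)"
    unfolding euler_orthogonal_def coeff_smult coeff_sum
    by (intro arg_cong2[where f = "(*)"] sum.cong refl) auto
  then show ?thesis
    using assms pochhammer_of_nat_neq_0[of p n, where ?'a = complex]
    by (simp add: sum.delta flip: power_mult_distrib)
qed

text \<open>In the mixed moments (p)_(r+k) / (p)_k = (p + k)_r and the powers 2^k cancel, which
  leaves an n-fold difference of (a)_r at a = p.\<close>

lemma umbral_eval_euler_orthogonal:
  assumes "p \<ge> 1" "r \<le> n"
  shows "umbral_eval (\<lambda>k. higher_euler p k x) (pochhammer [:x, -1:] r * euler_orthogonal p x n) =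
    (if r = n then pochhammer (of_nat p) n * fact n / 4 ^ n else 0)"
proof -
  have "umbral_eval (\<lambda>k. higher_euler p k x) (pochhammer [:x, -1:] r * euler_orthogonal p x n) =
      (-1) ^ n * pochhammer (of_nat p) n / 2 ^ n *
      (\<Sum>k\<le>n. (-1) ^ k * of_nat (n choose k) * 2 ^ k / pochhammer (of_nat p) k *
        (pochhammer (of_nat p) (r + k) / 2 ^ (r + k)))"
    by (simp add: euler_orthogonal_def sum_distrib_left umbral_eval_smult umbral_eval_sum
        umbral_eval_higher_euler_pochhammer)
  also have "\<dots> = (-1) ^ n * pochhammer (of_nat p) n / 2 ^ (n + r) *
      (\<Sum>k\<le>n. (-1) ^ k * of_nat (n choose k) * pochhammer (of_nat p + of_nat k) r)"
    using pochhammer_of_nat_neq_0[OF \<open>p \<ge> 1\<close>, where ?'a = complex]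
    by (simp add: sum_distrib_left add.commute[of r] pochhammer_product' power_add field_simps)
  also have "\<dots> = (if r = n then pochhammer (of_nat p) n * fact n / 4 ^ n else 0)"
    unfolding alternating_sum_pochhammer[OF \<open>r \<le> n\<close>]
    by (simp add: power_add flip: power_mult_distrib)
  finally show ?thesis .
qed

lemma monic_orthogonal_euler_orthogonal:
  assumes "p \<ge> 1"
  shows "monic_orthogonal_poly (\<lambda>k. higher_euler p k x) n (euler_orthogonal p x n)"
    and "umbral_eval (\<lambda>k. higher_euler p k x)
      (euler_orthogonal p x n * euler_orthogonal p x n) \<noteq> 0"
proof -
  let ?L = "umbral_eval (\<lambda>k. higher_euler p k x)" and ?P = "euler_orthogonal p x n"
  have basis: "degree (pochhammer [:x, -1:] r) = r" "coeff (pochhammer [:x, -1:] r) r = (-1) ^ r"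
    for r using degree_pochhammer_linear[of "-1" x r] by auto
  have orth: "?L (q * ?P) = 0" if "\<And>i. i \<ge> n \<Longrightarrow> coeff q i = 0" for q
    by (rule umbral_eval_mult_eq_0[of n "pochhammer [:x, -1:]"])
      (use that assms basis in \<open>auto simp: umbral_eval_euler_orthogonal simp flip: leading_coeff_0_iff\<close>)
  have coeff: "coeff ?P i = (if i = n then 1 else 0)" if "i \<ge> n" for i
    using coeff_euler_orthogonal assms that .
  have deg: "degree ?P = n"
    by (intro antisym degree_le le_degree) (auto simp: coeff)
  show "monic_orthogonal_poly (\<lambda>k. higher_euler p k x) n ?P"
    unfolding monic_orthogonal_poly_def using deg coeff[of n]
    by (auto intro!: orth)
  \<comment> \<open>Both terms are monic of degree \<open>n\<close>, so \<open>q\<close> has only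
    lower terms and is orthogonal to \<open>?P\<close>. This reduces the squared norm to the known
    pairing of \<open>?P\<close> with (-u)_n.\<close>
  define q where "q = ?P - smult ((-1) ^ n) (pochhammer [:x, -1:] n)"
  have "?L (q * ?P) = 0"
  proof (rule orth)
    show "coeff q i = 0" if "i \<ge> n" for i
      using that basis[of n] by (cases "i = n") (auto simp: q_def coeff coeff_eq_0 simp flip: power_mult_distrib)
  qed
  then have "?L (?P * ?P) = (-1) ^ n * (pochhammer (of_nat p) n * fact n / 4 ^ n)"
    using umbral_eval_euler_orthogonal[OF assms, of n n x]
    by (simp add: q_def left_diff_distrib umbral_eval_diff umbral_eval_smult)
  then show "?L (?P * ?P) \<noteq> 0"
    using pochhammer_of_nat_neq_0[OF assms, of n, where ?'a = complex] by simp
qed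

section \<open>Identification with the Meixner-Pollaczek polynomial\<close>

text \<open>The series terminates because (-n)_k = (-1)^k k! (n choose k) vanishes for k >
  n.\<close>

lemma hypergeo_2F1_minus_of_nat:
  "hypergeo_2F1 (- of_nat n) b c z =
    (\<Sum>k\<le>n. (-1) ^ k * of_nat (n choose k) * pochhammer b k / pochhammer c k * z ^ k)"
proof -
  have "hypergeo_2F1 (- of_nat n) b c z =
      (\<Sum>k. pochhammer (- of_nat n) k * pochhammer b k / (pochhammer c k * fact k) * z ^ k)"
    by (simp add: hypergeo_2F1_def eval_fps_def)
  also have "\<dots> = (\<Sum>k\<le>n. pochhammer (- of_nat n) k * pochhammer b k / (pochhammer c k * fact k) * z ^ k)"
    by (rule suminf_finite) (auto simp: pochhammer_of_nat_eq_0_lemma)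
  also have "\<dots> = (\<Sum>k\<le>n. (-1) ^ k * of_nat (n choose k) * pochhammer b k / pochhammer c k * z ^ k)"
  proof (intro sum.cong refl)
    fix k
    have "pochhammer (- of_nat n :: complex) k = (-1) ^ k * of_nat (n choose k) * fact k"
      by (simp add: binomial_gbinomial gbinomial_pochhammer flip: power_mult_distrib)
    then show "pochhammer (- of_nat n) k * pochhammer b k / (pochhammer c k * fact k) * z ^ k =
        (-1) ^ k * of_nat (n choose k) * pochhammer b k / pochhammer c k * z ^ k"
      by simp
  qed
  finally show ?thesis .
qed

text \<open>At phi = pi/2 the hypergeometric argument is 1 - e^(-i pi) = 2, and the two halves p/2
  add up to the parameter p + y - x. The phase i^n and the prefactor i^n combine to (-1)^n.\<close>

lemma poly_euler_orthogonal:
  "poly (euler_orthogonal p x n) y = \<i> ^ n * fact n / 2 ^ n *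
     meixner_pollaczek n (real p / 2) (- \<i> * (y - x + of_nat p / 2)) (pi / 2)"
proof -
  have exp1: "exp (\<i> * of_nat n * of_real (pi / 2)) = \<i> ^ n"
  proof -
    have "exp (\<i> * of_nat n * of_real (pi / 2)) = exp (\<i> * of_real (pi / 2)) ^ n"
      by (simp flip: exp_of_nat_mult add: mult_ac)
    also have "exp (\<i> * of_real (pi / 2)) = \<i>"
      by (metis cis_conv_exp cis_pi_half)
    finally show ?thesis .
  qed
  have exp2: "1 - exp (- 2 * \<i> * of_real (pi / 2)) = 2"
    by (simp add: exp_minus)
  have arg: "of_real (real p / 2) + \<i> * (- \<i> * (y - x + of_nat p / 2)) = of_nat p - x + y"
    by (simp add: algebra_simps)
  have sign: "\<i> ^ n * \<i> ^ n = (-1) ^ n"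
    by (simp flip: power_mult_distrib)
  have poch: "of_real (pochhammer (2 * (real p / 2)) n / fact n) = (pochhammer (of_nat p) n / fact n :: complex)"
    by (simp add: pochhammer_of_real[symmetric])
  have c: "of_real (2 * (real p / 2)) = (of_nat p :: complex)"
    by simp
  have "\<i> ^ n * fact n / 2 ^ n *
      meixner_pollaczek n (real p / 2) (- \<i> * (y - x + of_nat p / 2)) (pi / 2) =
    \<i> ^ n * \<i> ^ n * pochhammer (of_nat p) n / 2 ^ n *
      hypergeo_2F1 (- of_nat n) (of_nat p - x + y) (of_nat p) 2"
    unfolding meixner_pollaczek_def exp1 exp2 arg poch c by simp
  also have "\<dots> = poly (euler_orthogonal p x n) y"
    by (simp add: sign hypergeo_2F1_minus_of_nat euler_orthogonal_def poly_sum poly_pochhammer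
        mult_ac)
  finally show ?thesis ..
qed

theorem theorem2p5:
  fixes n p :: nat and x :: complex
  assumes "n \<ge> 1" and "p \<ge> 1"
  shows "(\<exists>!\<Omega>. monic_orthogonal_poly (\<lambda>k. higher_euler p k x) n \<Omega>) \<and>
         (\<forall>\<Omega>. monic_orthogonal_poly (\<lambda>k. higher_euler p k x) n \<Omega> \<longrightarrow>
           (\<forall>y. poly \<Omega> y =
             \<i> ^ n * fact n / 2 ^ n *
             meixner_pollaczek n (real p / 2) (- \<i> * (y - x + of_nat p / 2)) (pi / 2)))"
proof -
  \<comment> \<open>The explicit family itself supplies the nonzero squared norms in all degrees
    below \<open>n\<close>.\<close>
  have "\<Omega> = euler_orthogonal p x n"
    if "monic_orthogonal_poly (\<lambda>k. higher_euler p k x) n \<Omega>" for \<Omega>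
    using monic_orthogonal_poly_unique[of n _ "euler_orthogonal p x", OF _ that]
      monic_orthogonal_euler_orthogonal[OF \<open>p \<ge> 1\<close>] by blast
  then show ?thesis
    using monic_orthogonal_euler_orthogonal(1)[OF \<open>p \<ge> 1\<close>, of x n] poly_euler_orthogonal
    by blast
qed

end
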